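(* Fix $k\ge 1$ and, for $n\geq 1$, let $T_n^k=\{1,3,5,\dots,2k-1\}\sqcup\{2k,2k+2,\dots,2(k+n-1)\}$. We have $$\sum_{n\geq 1}\Lambda_{T_n^k}\,u^{n-1} = 1 + \sum_{n\geq 2}\frac{(y+\bar{x})^{(n-2)}\,\Lambda_{T_2^k}(x+(n-2),\bar{x}+(n-2))\,u^{n-1}}{\prod_{i=0}^{n-2}\left(1-(\bar{y} - y - (\bar{x}+i))u\right)},$$ where $\Lambda_{T_n^k}=\Lambda_{T_n^k}(x,y,z,\bar x,\bar y,\bar z)$, $\Lambda_{T_2^k}(x+j,\bar x+j)=\Lambda_{T_2^k}(x+j,y,z,\bar x+j,\bar y,\bar z)$, and $a^{(n)}$ is the rising factorial $a(a+1)\cdots(a+(n-1))$.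
   Context: The identity is one of formal power series in $u$ with coefficients in $\mathbb{Z}[x,y,z,\bar x,\bar y,\bar z]$; $a^{(0)}=1$. The set $T_n^k$ consists of the $k$ odd integers $1,3,\dots,2k-1$ and the $n$ consecutive even integers $2k,2k+2,\dots,2(k+n-1)$. Let $S$ be a finite set of positive integers whose largest element $2N$ is even. If $S$ has at least two even elements and $2M$ is its second-largest even element, then $S'=\{s\in S: s\le 2M\}$; if $S$ has only one even element, $S'=\emptyset$. A generalized surjective staircase with domain $S$ is a surjective function $F$ from $S$ onto the set of even elements of $S$ with $F(a)\ge a$ for all $a\in S$. $\mathcal{E}_S$ is the set of all of these. For $F\in\mathcal{E}_S$ define: - An odd $2i-1\in S'$ is a surfixed point of $F$ if $F(2i-1)$ is the least even element of $S$ larger than $2i-1$. It is isolated if there is no $j\in S$, $j\neq 2i-1$, with $F(j)=F(2i-1)$, and doubled otherwise. $\mathrm{si}(F)$ and $\mathrm{sd}(F)$ are the numbers of isolated and doubled surfixed points. - An even $2i\in S'$ is a fixed point of $F$ if $F(2i)=2i$. It is isolated if there is no $j\in S$, $j\ne 2i$, with $F(j)=2i$, and doubled otherwise. $\mathrm{fi}(F)$ and $\mathrm{fd}(F)$ are the numbers of isolated and doubled fixed points. - An odd (respectively even) element $a\in S'$ is an odd (respectively even) maximum of $F$ if $F(a)=\max S$. $\mathrm{mo}(F)$ and $\mathrm{me}(F)$ are the numbers of odd and even maxima. Elements of $S\setminus S'$ do not count for any statistic. In commuting variables, $$\Lambda_S(x,y,z,\bar x,\bar y,\bar z)=\sum_{F\in\mathcal{E}_S}x^{\mathrm{mo}(F)}y^{\mathrm{fd}(F)}z^{\mathrm{si}(F)}\bar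 x^{\mathrm{me}(F)}\bar y^{\mathrm{fi}(F)}\bar z^{\mathrm{sd}(F)}.$$ *)

theory Defs
  imports "HOL-Analysis.Analysis" "HOL-Library.Poly_Mapping"
begin

definition evens :: "nat set \<Rightarrow> nat set" where
  "evens S = {s \<in> S. even s}"

text \<open>\<open>trunc S\<close> is the set written S'; \<open>evens S - {Max (evens S)}\<close> has maximum the second-largest
  even element of \<open>S\<close>.\<close>

definition trunc :: "nat set \<Rightarrow> nat set" where
  "trunc S = (if card (evens S) \<ge> 2
     then {s \<in> S. s \<le> Max (evens S - {Max (evens S)})} else {})"

text \<open>The extensional function space is used so that staircases that agree on \<open>S\<close> are equal as
  HOL functions and are counted once.\<close>

definition staircases :: "nat set \<Rightarrow> (nat \<Rightarrow> nat) set" where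
  "staircases S = {F \<in> S \<rightarrow>\<^sub>E evens S. F ` S = evens S \<and> (\<forall>a\<in>S. a \<le> F a)}"

definition surfixed :: "nat set \<Rightarrow> (nat \<Rightarrow> nat) \<Rightarrow> nat set" where
  "surfixed S F = {a \<in> trunc S. odd a \<and> F a = Min {e \<in> evens S. a < e}}"

definition fixed :: "nat set \<Rightarrow> (nat \<Rightarrow> nat) \<Rightarrow> nat set" where
  "fixed S F = {a \<in> trunc S. even a \<and> F a = a}"

text \<open>The witness \<open>j\<close> ranges over all of \<open>S\<close>, not only over \<open>trunc S\<close>.\<close>

definition doubled :: "nat set \<Rightarrow> (nat \<Rightarrow> nat) \<Rightarrow> nat \<Rightarrow> bool" where
  "doubled S F a \<longleftrightarrow> (\<exists>j\<in>S. j \<noteq> a \<and> F j = F a)"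

definition si :: "nat set \<Rightarrow> (nat \<Rightarrow> nat) \<Rightarrow> nat" where
  "si S F = card {a \<in> surfixed S F. \<not> doubled S F a}"

definition sd :: "nat set \<Rightarrow> (nat \<Rightarrow> nat) \<Rightarrow> nat" where
  "sd S F = card {a \<in> surfixed S F. doubled S F a}"

definition fi :: "nat set \<Rightarrow> (nat \<Rightarrow> nat) \<Rightarrow> nat" where
  "fi S F = card {a \<in> fixed S F. \<not> doubled S F a}"

definition fd :: "nat set \<Rightarrow> (nat \<Rightarrow> nat) \<Rightarrow> nat" where
  "fd S F = card {a \<in> fixed S F. doubled S F a}"

definition mo :: "nat set \<Rightarrow> (nat \<Rightarrow> nat) \<Rightarrow> nat" where
  "mo S F = card {a \<in> trunc S. odd a \<and> F a = Max S}"

definition me :: "nat set \<Rightarrow> (nat \<Rightarrow> nat) \<Rightarrow> nat" where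
  "me S F = card {a \<in> trunc S. even a \<and> F a = Max S}"

text \<open>The arguments \<open>x y z xb yb zb\<close> (\<open>b\<close> for bar) may be any elements of a commutative ring, so
  that substituting into the polynomial is plain application. The polynomial itself is obtained at
  the six indeterminates below.\<close>

definition Lambda :: "nat set \<Rightarrow> 'a \<Rightarrow> 'a \<Rightarrow> 'a \<Rightarrow> 'a \<Rightarrow> 'a \<Rightarrow> 'a \<Rightarrow> 'a::comm_ring_1" where
  "Lambda S x y z xb yb zb = (\<Sum>F\<in>staircases S.
     x ^ mo S F * y ^ fd S F * z ^ si S F * xb ^ me S F * yb ^ fi S F * zb ^ sd S F)"

definition T :: "nat \<Rightarrow> nat \<Rightarrow> nat set" where
  "T k n = {2 * i - 1 | i. 1 \<le> i \<and> i \<le> k} \<union> {2 * i | i. k \<le> i \<and> i \<le> k + n - 1}"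

datatype indet = Vx | Vy | Vz | Vxb | Vyb | Vzb

text \<open>Integer polynomials in six commuting indeterminates, as finitely supported functions from
  exponent vectors to coefficients.\<close>

type_synonym poly6 = "(indet \<Rightarrow>\<^sub>0 nat) \<Rightarrow>\<^sub>0 int"

definition Ind :: "indet \<Rightarrow> poly6" where
  "Ind v = Poly_Mapping.single (Poly_Mapping.single v 1) 1"

abbreviation "X \<equiv> Ind Vx"
abbreviation "Y \<equiv> Ind Vy"
abbreviation "Z \<equiv> Ind Vz"
abbreviation "Xb \<equiv> Ind Vxb"
abbreviation "Yb \<equiv> Ind Vyb"
abbreviation "Zb \<equiv> Ind Vzb"

text \<open>Division by a power series with constant term 1. The class-based \<open>/\<close> on \<^typ>\<open>'a fps\<close> needs
  division on the coefficients, which \<^typ>\<open>poly6\<close> does not have.\<close>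

definition fps_over :: "'a::comm_ring_1 fps \<Rightarrow> 'a fps \<Rightarrow> 'a fps" where
  "fps_over f g = f * fps_right_inverse g 1"

lemma fps_over_mult:
  assumes "fps_nth g 0 = 1"
  shows "fps_over f g * g = f"
  using fps_right_inverse[of g 1] assms by (simp add: fps_over_def mult.left_commute mult.commute)

end

theory Submission
  imports Defs
begin

unbundle no vec_syntax and fps_syntax

text \<open>The identity is the unfolding of a one-step recurrence in \<open>n\<close>. For \<open>n \<ge> 2\<close>
  (\<open>Lambda_T_Suc\<close>), with \<open>\<Lambda>\<^sub>n(x, xb)\<close> for the polynomial of \<open>T k n\<close>,
  \<open>\<Lambda>\<^sub>n\<^sub>+\<^sub>1(x, xb) = (y + xb) \<Lambda>\<^sub>n(x + 1, xb + 1) + (yb - y - xb) \<Lambda>\<^sub>n(x, xb)\<close>.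

  The recurrence comes from adjoining a new largest even element \<open>p\<close> to a domain \<open>S\<close> whose largest
  element \<open>m\<close> is even and whose odd elements all lie below the second-largest even one.
  Identifying the values \<open>m\<close> and \<open>p\<close> turns a staircase \<open>F\<close> on \<open>S \<union> {p}\<close> into a staircase \<open>G\<close> on \<open>S\<close>. The preimages \<open>F\<close> of \<open>G\<close> correspond to the sets \<open>B\<close> of elements whose value
  is raised from \<open>m\<close> to \<open>p\<close>: if \<open>A\<close> is the set of maxima of \<open>G\<close>, the fiber of \<open>G\<close> over \<open>m\<close> is
  \<open>A \<union> {m}\<close>, and \<open>B\<close> can be any proper subset of it, since some element must keep the
  value \<open>m\<close>. The maxima of \<open>F\<close> are the elements of \<open>B\<close>; the surfixed points and the fixed points
  below \<open>m\<close> are those of \<open>G\<close>, with the same multiplicity type. Only \<open>m\<close> itself is new. If it is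
  not raised, it is a fixed point, isolated when \<open>B = A\<close> and doubled otherwise, with weight \<open>yb\<close> or
  \<open>y\<close>; if it is raised, it is an even maximum, with weight \<open>xb\<close>, and then \<open>B - {m}\<close> is not all of
  \<open>A\<close>. A free choice of \<open>B - {m}\<close> inside \<open>A\<close> replaces \<open>x\<close> by \<open>x + 1\<close> and \<open>xb\<close> by \<open>xb + 1\<close>, with
  factor \<open>y + xb\<close>, and the exceptional choice \<open>B - {m} = A\<close> contributes the correction
  \<open>yb - y - xb\<close> (\<open>Lambda_insert_top\<close>).

  Let \<open>G\<^sub>j\<close> be the generating function \<open>\<Sum>\<^sub>m \<Lambda>\<^sub>m\<^sub>+\<^sub>2(x + j, xb + j) u\<^sup>m\<close>. The recurrence reads
  \<open>(1 - (yb - y - (xb + j)) u) G\<^sub>j = \<Lambda>\<^sub>2(x + j, xb + j) + (y + xb + j) u G\<^sub>j\<^sub>+\<^sub>1\<close>. Substituting this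
  equation into itself produces the summands of the right-hand side one after the other, and the
  remainder after \<open>M\<close> steps is divisible by \<open>u\<^sup>M\<close>, so the expansion converges
  (\<open>functional_equation_solution\<close>). The initial summand 1 is \<open>\<Lambda>\<^sub>1\<close>.\<close>

section \<open>Adding a new largest even element to the domain\<close>

definition raise_top :: "nat \<Rightarrow> nat set \<Rightarrow> (nat \<Rightarrow> nat) \<Rightarrow> nat \<Rightarrow> nat" where
  "raise_top p B G = (\<lambda>a. if a = p \<or> a \<in> B then p else G a)"

text \<open>The map \<open>merge_top\<close> identifies the values \<open>m\<close> and \<open>p\<close>. It restricts to \<open>S\<close> because
  staircases are extensional functions; together with the set of raised elements it inverts
  \<open>raise_top\<close>.\<close>

definition merge_top :: "nat \<Rightarrow> nat \<Rightarrow> nat set \<Rightarrow> (nat \<Rightarrow> nat) \<Rightarrow> nat \<Rightarrow> nat" where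
  "merge_top m p S F = restrict (\<lambda>a. if F a = p then m else F a) S"

definition maxima :: "nat set \<Rightarrow> (nat \<Rightarrow> nat) \<Rightarrow> nat set" where
  "maxima S F = {a \<in> trunc S. F a = Max S}"

lemma finite_trunc: "finite S \<Longrightarrow> finite (trunc S)"
  by (auto simp: trunc_def)

lemma maxima_weight:
  fixes x xb :: "'a::comm_ring_1"
  assumes "finite S"
  shows "(\<Prod>a\<in>maxima S F. if odd a then x else xb) = x ^ mo S F * xb ^ me S F"
proof -
  have fin: "finite (maxima S F)"
    using finite_trunc[OF assms] by (simp add: maxima_def)
  have "{a \<in> maxima S F. odd a} = {a \<in> trunc S. odd a \<and> F a = Max S}"
    "{a \<in> maxima S F. \<not> odd a} = {a \<in> trunc S. even a \<and> F a = Max S}"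
    by (auto simp: maxima_def)
  then show ?thesis
    using prod.If_cases[OF fin, of odd "\<lambda>_. x" "\<lambda>_. xb"]
    by (simp add: mo_def me_def Int_def Collect_neg_eq[symmetric])
qed

text \<open>The assumption on \<open>trunc S\<close> says that no odd element of \<open>S\<close> lies between its two largest even
  elements, or that \<open>S = {m}\<close>. Such an odd element does not count for the statistics on \<open>S\<close>, but it
  would start to count on \<open>insert p S\<close>.\<close>

locale even_top =
  fixes S :: "nat set" and m p :: nat
  assumes finite_S: "finite S"
    and top_mem: "m \<in> S" and even_m: "even m" and S_le: "\<And>a. a \<in> S \<Longrightarrow> a \<le> m"
    and trunc_S: "trunc S = S - {m}"
    and even_p: "even p" and m_less_p: "m < p"
begin

lemma p_notin: "p \<notin> S"
  using S_le m_less_p by force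

lemma Max_S: "Max S = m"
  using finite_S top_mem S_le by (intro Max_eqI) auto

lemma evens_insert: "evens (insert p S) = insert p (evens S)"
  using even_p by (auto simp: evens_def)

lemma finite_evens: "finite (evens S)"
  using finite_S by (simp add: evens_def)

lemma top_evens: "m \<in> evens S"
  using top_mem even_m by (simp add: evens_def)

lemma evens_le: "e \<in> evens S \<Longrightarrow> e \<le> m"
  using S_le by (simp add: evens_def)

lemma Max_evens: "Max (evens S) = m"
  using finite_evens top_evens evens_le by (intro Max_eqI) auto

lemma Max_insert: "Max (insert p S) = p"
  using finite_S S_le m_less_p by (intro Max_eqI) (auto intro: less_imp_le le_less_trans)

lemma trunc_insert: "trunc (insert p S) = S"
proof -
  have p: "p \<notin> evens S" using p_notin by (simp add: evens_def)
  have "card (evens (insert p S)) \<ge> 2"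
  proof -
    have "card {m, p} \<le> card (evens (insert p S))"
      using finite_evens top_evens by (intro card_mono) (auto simp: evens_insert)
    then show ?thesis using m_less_p by simp
  qed
  moreover have "Max (evens (insert p S)) = p"
    unfolding evens_insert using finite_evens evens_le m_less_p
    by (intro Max_eqI) (auto intro: less_imp_le le_less_trans)
  moreover have "insert p (evens S) - {p} = evens S" using p by auto
  ultimately show ?thesis
    using S_le m_less_p by (auto simp: trunc_def evens_insert Max_evens)
qed

text \<open>Every odd element of \<open>S\<close> belongs to \<open>trunc S\<close>, so an even element of \<open>S\<close> lies strictly between
  it and \<open>m\<close>. The value that makes it surfixed therefore stays below \<open>m\<close>, out of reach of moving
  values from \<open>m\<close> to \<open>p\<close>.\<close>

lemma least_even_above:
  assumes "a \<in> S" "odd a"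
  shows "Min {e \<in> insert p (evens S). a < e} = Min {e \<in> evens S. a < e}"
    and "Min {e \<in> evens S. a < e} < m"
proof -
  have a: "a \<in> trunc S" using assms even_m by (auto simp: trunc_S)
  then have c: "card (evens S) \<ge> 2" and "a \<le> Max (evens S - {m})"
    by (auto simp: trunc_def Max_evens split: if_splits)
  have "card (evens S - {m}) \<noteq> 0"
    using c top_evens finite_evens by simp
  then have "evens S - {m} \<noteq> {}" by force
  then have "Max (evens S - {m}) \<in> evens S - {m}"
    using finite_evens by (intro Max_in) auto
  then obtain e where e: "e \<in> evens S" "e \<noteq> m" "a \<le> e"
    using \<open>a \<le> Max (evens S - {m})\<close> by blast
  have "a \<noteq> e" using assms e by (auto simp: evens_def)
  then have lt: "a < e" "e < m" using e evens_le by force+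
  have fin: "finite {e \<in> evens S. a < e}" using finite_evens by simp
  then have "Min {e \<in> evens S. a < e} \<le> e"
    using e lt by (intro Min_le) auto
  then show less: "Min {e \<in> evens S. a < e} < m"
    using lt(2) by simp
  have "a < p" using lt m_less_p by simp
  then have "{e \<in> insert p (evens S). a < e} = insert p {e \<in> evens S. a < e}" by auto
  moreover have "Min (insert p {e \<in> evens S. a < e}) = min p (Min {e \<in> evens S. a < e})"
    using fin e lt by (intro Min_insert) auto
  ultimately show "Min {e \<in> insert p (evens S). a < e} = Min {e \<in> evens S. a < e}"
    using less m_less_p by simp
qed

lemma staircaseD:
  assumes "G \<in> staircases S"
  shows "a \<in> S \<Longrightarrow> G a \<in> evens S" "a \<in> S \<Longrightarrow> a \<le> G a" "a \<in> S \<Longrightarrow> G a \<le> m"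
    "a \<notin> S \<Longrightarrow> G a = undefined" "G ` S = evens S" "G m = m"
proof -
  show *: "a \<in> S \<Longrightarrow> G a \<in> evens S" "a \<in> S \<Longrightarrow> a \<le> G a" "a \<notin> S \<Longrightarrow> G a = undefined"
    "G ` S = evens S" for a
    using assms by (auto simp: staircases_def)
  show "a \<in> S \<Longrightarrow> G a \<le> m" for a
    using *(1) evens_le by blast
  then show "G m = m" using *(2) top_mem le_antisym by blast
qed

lemma raise_staircase:
  assumes G: "G \<in> staircases S" and B: "B \<subset> {a \<in> S. G a = m}"
  shows "raise_top p B G \<in> staircases (insert p S)"
proof -
  note G' = staircaseD[OF G]
  have B': "B \<subseteq> S" "\<And>b. b \<in> B \<Longrightarrow> G b = m" using B by auto
  obtain b where b: "b \<in> S" "G b = m" "b \<notin> B" using B by blast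
  have "raise_top p B G ` insert p S = insert p (evens S)"
  proof (intro equalityI subsetI)
    fix v assume "v \<in> raise_top p B G ` insert p S"
    then show "v \<in> insert p (evens S)" using G'(1) by (auto simp: raise_top_def)
  next
    fix v assume v: "v \<in> insert p (evens S)"
    consider "v = p" | "v = m" | "v \<noteq> p" "v \<noteq> m" by blast
    then show "v \<in> raise_top p B G ` insert p S"
    proof cases
      case 1 then show ?thesis by (auto simp: raise_top_def)
    next
      case 2
      have "raise_top p B G b = m" using b p_notin by (auto simp: raise_top_def)
      then show ?thesis using 2 b by blast
    next
      case 3
      then have "v \<in> G ` S" using v G'(5) by auto
      then obtain a where a: "a \<in> S" "v = G a" by blast
      have "raise_top p B G a = v" using a 3 B' p_notin by (auto simp: raise_top_def)
      then show ?thesis using a by blast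
    qed
  qed
  moreover have "a \<le> raise_top p B G a" if "a \<in> insert p S" for a
    using that G'(2) S_le m_less_p by (auto simp: raise_top_def intro: less_imp_le le_less_trans)
  moreover have "raise_top p B G \<in> insert p S \<rightarrow>\<^sub>E insert p (evens S)"
  proof (rule PiE_I)
    fix a assume "a \<in> insert p S"
    then show "raise_top p B G a \<in> insert p (evens S)" using G'(1) by (auto simp: raise_top_def)
  next
    fix a assume "a \<notin> insert p S"
    then show "raise_top p B G a = undefined" using G'(4) B' by (auto simp: raise_top_def)
  qed
  ultimately show ?thesis by (simp add: staircases_def evens_insert)
qed

lemma staircase_insertD:
  assumes "F \<in> staircases (insert p S)"
  shows "a \<in> S \<Longrightarrow> F a \<in> insert p (evens S)" "a \<in> S \<Longrightarrow> a \<le> F a" "F p = p"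
    "a \<notin> insert p S \<Longrightarrow> F a = undefined" "F ` insert p S = insert p (evens S)"
proof -
  show *: "a \<in> S \<Longrightarrow> F a \<in> insert p (evens S)" "a \<in> S \<Longrightarrow> a \<le> F a"
    "a \<notin> insert p S \<Longrightarrow> F a = undefined" "F ` insert p S = insert p (evens S)" for a
    using assms by (auto simp: staircases_def evens_insert)
  have "p \<le> F p" "F p \<in> insert p (evens S)"
    using assms by (auto simp: staircases_def evens_insert)
  then show "F p = p" using evens_le m_less_p by force
qed

lemma merge_staircase:
  assumes F: "F \<in> staircases (insert p S)"
  shows "merge_top m p S F \<in> staircases S"
    and "{a \<in> S. F a = p} \<subset> {a \<in> S. merge_top m p S F a = m}"
proof -
  note F' = staircase_insertD[OF F]
  have hit: "\<exists>a\<in>S. F a = v" if "v \<in> evens S" for v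
  proof -
    have "v \<in> F ` insert p S" using that F'(5) by simp
    moreover have "v \<noteq> F p" using that F'(3) evens_le m_less_p by force
    ultimately show ?thesis by auto
  qed
  have mp: "v \<noteq> p" if "v \<in> evens S" for v
    using evens_le[OF that] m_less_p by simp
  have "merge_top m p S F ` S = evens S"
  proof (intro equalityI subsetI)
    fix v assume "v \<in> merge_top m p S F ` S"
    then show "v \<in> evens S" using F'(1) top_evens by (auto simp: merge_top_def)
  next
    fix v assume v: "v \<in> evens S"
    then obtain a where "a \<in> S" "F a = v" using hit by blast
    then show "v \<in> merge_top m p S F ` S" using mp[OF v] by (auto simp: merge_top_def image_iff)
  qed
  moreover have "merge_top m p S F \<in> S \<rightarrow>\<^sub>E evens S"
    using F'(1) top_evens by (fastforce simp: merge_top_def)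
  moreover have "a \<le> merge_top m p S F a" if "a \<in> S" for a
    using that F'(2) S_le by (auto simp: merge_top_def)
  ultimately show "merge_top m p S F \<in> staircases S" by (simp add: staircases_def)
  obtain b where "b \<in> S" "F b = m" using hit top_evens by blast
  then have "b \<in> {a \<in> S. merge_top m p S F a = m}" "b \<notin> {a \<in> S. F a = p}"
    using m_less_p by (auto simp: merge_top_def)
  moreover have "{a \<in> S. F a = p} \<subseteq> {a \<in> S. merge_top m p S F a = m}"
    by (auto simp: merge_top_def)
  ultimately show "{a \<in> S. F a = p} \<subset> {a \<in> S. merge_top m p S F a = m}"
    by blast
qed

lemma raise_fiber:
  assumes G: "G \<in> staircases S" and B: "B \<subseteq> {a \<in> S. G a = m}"
  shows "{a \<in> S. raise_top p B G a = p} = B"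
  using staircaseD(3)[OF G] B m_less_p p_notin by (force simp: raise_top_def)

lemma merge_raise:
  assumes G: "G \<in> staircases S" and B: "B \<subseteq> {a \<in> S. G a = m}"
  shows "merge_top m p S (raise_top p B G) = G"
proof
  fix a
  show "merge_top m p S (raise_top p B G) a = G a"
  proof (cases "a \<in> S")
    case True
    then have "G a \<noteq> p" using staircaseD(3)[OF G True] m_less_p by simp
    then show ?thesis using True B p_notin by (auto simp: merge_top_def raise_top_def)
  qed (simp add: merge_top_def staircaseD(4)[OF G])
qed

lemma raise_merge:
  assumes F: "F \<in> staircases (insert p S)"
  shows "raise_top p {a \<in> S. F a = p} (merge_top m p S F) = F"
  using staircase_insertD(3,4)[OF F] by (auto simp: fun_eq_iff raise_top_def merge_top_def)

text \<open>A staircase on \<open>insert p S\<close> is a staircase on \<open>S\<close> together with a choice of the elements to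
  raise. Proper inclusion is surjectivity at \<open>m\<close>; surjectivity at \<open>p\<close> is automatic because \<open>p\<close> is
  always sent to itself.\<close>

lemma sum_staircases_insert:
  "(\<Sum>F\<in>staircases (insert p S). h F) =
     (\<Sum>G\<in>staircases S. \<Sum>B\<in>{B. B \<subset> {a \<in> S. G a = m}}. h (raise_top p B G))"
proof -
  have "staircases S \<subseteq> S \<rightarrow>\<^sub>E evens S" by (auto simp: staircases_def)
  then have fin: "finite (staircases S)"
    using finite_PiE[of S "\<lambda>_. evens S"] finite_S finite_evens finite_subset by blast
  have fin': "finite {B. B \<subset> {a \<in> S. G a = m}}" for G
    by (rule finite_subset[of _ "Pow S"]) (use finite_S in auto)
  have "(\<Sum>F\<in>staircases (insert p S). h F) =
    (\<Sum>(G, B)\<in>(SIGMA G:staircases S. {B. B \<subset> {a \<in> S. G a = m}}). h (raise_top p B G))"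
  proof (rule sum.reindex_bij_witness
      [where i = "\<lambda>(G, B). raise_top p B G" and j = "\<lambda>F. (merge_top m p S F, {a \<in> S. F a = p})"],
      goal_cases)
    case (1 F)
    then show ?case by (simp add: raise_merge)
  next
    case (2 F)
    then show ?case using merge_staircase by simp
  next
    case (3 GB)
    then obtain G B where "GB = (G, B)" "G \<in> staircases S" "B \<subset> {a \<in> S. G a = m}" by auto
    then show ?case using merge_raise[of G B] raise_fiber[of G B] by (simp add: psubset_imp_subset)
  next
    case (4 GB)
    then show ?case using raise_staircase by (cases GB) simp
  next
    case (5 F)
    then show ?case by (simp add: raise_merge)
  qed
  also have "\<dots> = (\<Sum>G\<in>staircases S. \<Sum>B\<in>{B. B \<subset> {a \<in> S. G a = m}}. h (raise_top p B G))"
    using fin fin' by (subst sum.Sigma) auto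
  finally show ?thesis .
qed

context
  fixes G B
  assumes G: "G \<in> staircases S" and B: "B \<subset> {a \<in> S. G a = m}"
begin

text \<open>Values below \<open>m\<close> are taken at the same places before and after raising. All invariance
  statements about surfixed and fixed points rest on this.\<close>

lemma raise_eq_iff:
  assumes "v < m" "j \<in> insert p S"
  shows "raise_top p B G j = v \<longleftrightarrow> j \<in> S \<and> G j = v"
  using assms B p_notin m_less_p by (auto simp: raise_top_def)

lemma doubled_raise:
  assumes "G a < m" "a \<in> S"
  shows "doubled (insert p S) (raise_top p B G) a \<longleftrightarrow> doubled S G a"
proof -
  have "raise_top p B G a = G a" using raise_eq_iff[of "G a" a] assms by simp
  then show ?thesis
    using raise_eq_iff[OF assms(1)] by (auto simp: doubled_def)
qed

lemma surfixed_raise: "surfixed (insert p S) (raise_top p B G) = surfixed S G"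
proof -
  have "raise_top p B G a = Min {e \<in> evens (insert p S). a < e} \<longleftrightarrow> G a = Min {e \<in> evens S. a < e}"
    if "a \<in> S" "odd a" for a
    using raise_eq_iff[of "Min {e \<in> evens S. a < e}" a] least_even_above[OF that] that
    by (simp add: evens_insert)
  moreover have "a \<in> S \<and> odd a \<longleftrightarrow> a \<in> S - {m} \<and> odd a" for a
    using even_m by auto
  ultimately show ?thesis
    unfolding surfixed_def trunc_insert trunc_S by blast
qed

lemma surfixed_below:
  assumes "a \<in> surfixed S G"
  shows "a \<in> S \<and> G a < m"
proof -
  have a: "a \<in> S" "odd a" and eq: "G a = Min {e \<in> evens S. a < e}"
    using assms unfolding surfixed_def trunc_S by blast+
  show ?thesis using a(1) least_even_above(2)[OF a] unfolding eq by (rule conjI)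
qed

lemma si_raise: "si (insert p S) (raise_top p B G) = si S G"
  unfolding si_def surfixed_raise
  by (intro arg_cong[where f = card] Collect_cong conj_cong refl)
    (simp add: doubled_raise surfixed_below)

lemma sd_raise: "sd (insert p S) (raise_top p B G) = sd S G"
  unfolding sd_def surfixed_raise
  by (intro arg_cong[where f = card] Collect_cong conj_cong refl)
    (simp add: doubled_raise surfixed_below)

lemma maxima_raise: "maxima (insert p S) (raise_top p B G) = B"
  using raise_fiber[OF G] B by (simp add: maxima_def trunc_insert Max_insert)

lemma fixed_raise:
  "fixed (insert p S) (raise_top p B G) = (if m \<in> B then {} else {m}) \<union> fixed S G"
proof -
  have "raise_top p B G a = a \<longleftrightarrow> G a = a" if "a \<in> S - {m}" for a
    using raise_eq_iff[of a a] that S_le[of a] by auto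
  moreover have "raise_top p B G m = m \<longleftrightarrow> m \<notin> B"
    using m_less_p staircaseD(6)[OF G] by (auto simp: raise_top_def)
  ultimately show ?thesis
    using even_m top_mem by (auto simp: fixed_def trunc_insert trunc_S)
qed

lemma fixed_below: "a \<in> fixed S G \<Longrightarrow> a \<in> S \<and> G a < m"
  using S_le by (auto simp: fixed_def trunc_S nat_less_le)

text \<open>When \<open>m\<close> keeps the value \<open>m\<close>, it is alone in doing so exactly if all former maxima have been
  raised.\<close>

lemma doubled_raise_top:
  assumes "m \<notin> B"
  shows "doubled (insert p S) (raise_top p B G) m \<longleftrightarrow> B \<noteq> maxima S G"
proof -
  have eq: "raise_top p B G m = m"
    using assms m_less_p staircaseD(6)[OF G] by (auto simp: raise_top_def)
  have "doubled (insert p S) (raise_top p B G) m \<longleftrightarrow> (\<exists>j\<in>S - {m}. G j = m \<and> j \<notin> B)"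
  proof -
    have "j \<in> insert p S \<and> j \<noteq> m \<and> raise_top p B G j = m \<longleftrightarrow> j \<in> S - {m} \<and> G j = m \<and> j \<notin> B" for j
      using m_less_p p_notin by (auto simp: raise_top_def)
    then show ?thesis unfolding doubled_def eq by blast
  qed
  then show ?thesis
    using B assms by (auto simp: maxima_def trunc_S Max_S)
qed

lemma fixed_weight_raise:
  fixes y yb :: "'a::comm_ring_1"
  shows "y ^ fd (insert p S) (raise_top p B G) * yb ^ fi (insert p S) (raise_top p B G) =
    (if m \<in> B then 1 else if B = maxima S G then yb else y) * (y ^ fd S G * yb ^ fi S G)"
proof -
  let ?S = "insert p S" and ?F = "raise_top p B G"
  have fin: "finite {a \<in> fixed S G. Q a}" for Q
    using finite_S by (simp add: fixed_def trunc_S)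
  have notin: "m \<notin> fixed S G" by (simp add: fixed_def trunc_S)
  have dbl: "doubled ?S ?F a \<longleftrightarrow> doubled S G a" if "a \<in> fixed S G" for a
    using fixed_below[OF that] by (simp add: doubled_raise)
  have "{a \<in> fixed ?S ?F. doubled ?S ?F a} =
      (if m \<notin> B \<and> B \<noteq> maxima S G then insert m {a \<in> fixed S G. doubled S G a}
       else {a \<in> fixed S G. doubled S G a})"
    using dbl doubled_raise_top by (auto simp: fixed_raise)
  then have fd: "fd ?S ?F = (if m \<notin> B \<and> B \<noteq> maxima S G then Suc (fd S G) else fd S G)"
    using fin notin by (simp add: fd_def)
  have "{a \<in> fixed ?S ?F. \<not> doubled ?S ?F a} =
      (if m \<notin> B \<and> B = maxima S G then insert m {a \<in> fixed S G. \<not> doubled S G a}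
       else {a \<in> fixed S G. \<not> doubled S G a})"
    using dbl doubled_raise_top by (auto simp: fixed_raise)
  then have fi: "fi ?S ?F = (if m \<notin> B \<and> B = maxima S G then Suc (fi S G) else fi S G)"
    using fin notin by (auto simp: fi_def maxima_def trunc_S)
  show ?thesis by (simp add: fd fi ac_simps)
qed

end

text \<open>Split over whether \<open>m \<in> B\<close> and put \<open>C = B - {m}\<close>. In both cases the sum over all \<open>C \<subseteq> A\<close>
  is the expansion of \<open>\<Prod>a\<in>A. w a + 1\<close>. The set \<open>C = A\<close> is exceptional: it has coefficient
  \<open>yb\<close> in place of \<open>y\<close> if \<open>m \<notin> B\<close>, and it is excluded if \<open>m \<in> B\<close>.\<close>

lemma sum_raised_sets:
  fixes y xb yb :: "'a::comm_ring_1" and w :: "nat \<Rightarrow> 'a"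
  assumes A: "finite A" "m \<notin> A" and w: "w m = xb"
  shows "(\<Sum>B\<in>{B. B \<subset> insert m A}. prod w B * (if m \<in> B then 1 else if B = A then yb else y))
    = (y + xb) * (\<Prod>a\<in>A. w a + 1) + (yb - y - xb) * prod w A" (is "sum ?h _ = _")
proof -
  have split: "{B. B \<subset> insert m A} = Pow A \<union> insert m ` (Pow A - {A})"
  proof (intro equalityI subsetI)
    fix B assume B: "B \<in> {B. B \<subset> insert m A}"
    show "B \<in> Pow A \<union> insert m ` (Pow A - {A})"
    proof (cases "m \<in> B")
      case True
      then have "B = insert m (B - {m})" "B - {m} \<in> Pow A - {A}" using B by auto
      then show ?thesis by blast
    qed (use B in auto)
  qed (use A in auto)
  have tot: "(\<Prod>a\<in>A. w a + 1) = sum (prod w) (Pow A)"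
    using prod_add[OF A(1), of w "\<lambda>_. 1"] by simp
  have "sum ?h (Pow A) = (\<Sum>C\<in>Pow A. y * prod w C + (if C = A then (yb - y) * prod w A else 0))"
    using A(2) by (intro sum.cong) (auto simp: algebra_simps)
  also have "\<dots> = y * (\<Prod>a\<in>A. w a + 1) + (yb - y) * prod w A"
    using A(1) by (simp add: sum.distrib sum_distrib_left tot)
  finally have 1: "sum ?h (Pow A) = y * (\<Prod>a\<in>A. w a + 1) + (yb - y) * prod w A" .
  have inj: "inj_on (insert m) (Pow A - {A})"
    using A(2) by (intro inj_onI) (metis DiffD1 PowD insert_ident subsetD)
  have "sum ?h (insert m ` (Pow A - {A})) = (\<Sum>C\<in>Pow A - {A}. ?h (insert m C))"
    using inj by (simp add: sum.reindex)
  also have "\<dots> = (\<Sum>C\<in>Pow A - {A}. xb * prod w C)"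
  proof (rule sum.cong)
    fix C assume "C \<in> Pow A - {A}"
    then have "finite C" "m \<notin> C" using A finite_subset by auto
    then show "?h (insert m C) = xb * prod w C" using w by simp
  qed simp
  also have "\<dots> = xb * ((\<Prod>a\<in>A. w a + 1) - prod w A)"
    using A(1) by (simp add: sum_distrib_left[symmetric] tot sum_diff1)
  finally have 2: "sum ?h (insert m ` (Pow A - {A})) = xb * ((\<Prod>a\<in>A. w a + 1) - prod w A)" .
  have "sum ?h {B. B \<subset> insert m A} = sum ?h (Pow A) + sum ?h (insert m ` (Pow A - {A}))"
    unfolding split using A by (intro sum.union_disjoint) auto
  then show ?thesis by (simp add: 1 2 algebra_simps)
qed

text \<open>Grouping the staircases on \<open>insert p S\<close> by the staircase on \<open>S\<close> from which they arise, the
  choice of raised elements contributes the sum of \<open>sum_raised_sets\<close>, where \<open>A\<close> is the set of maxima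
  and \<open>w\<close> gives weight \<open>x\<close> to odd and \<open>xb\<close> to even elements.\<close>

lemma Lambda_insert_top:
  fixes x y z xb yb zb :: "'a::comm_ring_1"
  shows "Lambda (insert p S) x y z xb yb zb =
    (y + xb) * Lambda S (x + 1) y z (xb + 1) yb zb + (yb - y - xb) * Lambda S x y z xb yb zb"
proof -
  let ?w = "\<lambda>a. if odd a then x else xb"
  let ?r = "\<lambda>G. y ^ fd S G * yb ^ fi S G * z ^ si S G * zb ^ sd S G"
  let ?c = "\<lambda>B G. if m \<in> B then 1 else if B = maxima S G then yb else y"
  have "Lambda (insert p S) x y z xb yb zb = (\<Sum>F\<in>staircases (insert p S).
      prod ?w (maxima (insert p S) F) *
      (y ^ fd (insert p S) F * yb ^ fi (insert p S) F) *
      (z ^ si (insert p S) F * zb ^ sd (insert p S) F))"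
    using finite_S by (simp add: Lambda_def maxima_weight ac_simps)
  also have "\<dots> = (\<Sum>G\<in>staircases S. \<Sum>B\<in>{B. B \<subset> {a \<in> S. G a = m}}.
      ?r G * (prod ?w B * ?c B G))"
    unfolding sum_staircases_insert
    by (intro sum.cong refl)
      (simp add: maxima_raise fixed_weight_raise si_raise sd_raise ac_simps)
  also have "\<dots> = (\<Sum>G\<in>staircases S. ?r G *
      ((y + xb) * ((x + 1) ^ mo S G * (xb + 1) ^ me S G) +
       (yb - y - xb) * (x ^ mo S G * xb ^ me S G)))"
  proof (rule sum.cong)
    fix G assume "G \<in> staircases S"
    then have "{a \<in> S. G a = m} = insert m (maxima S G)"
      using staircaseD(6) top_mem by (auto simp: maxima_def trunc_S Max_S)
    moreover have "finite (maxima S G)" "m \<notin> maxima S G"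
      using finite_S by (auto simp: maxima_def trunc_S)
    moreover have "(\<Prod>a\<in>maxima S G. ?w a + 1) = (\<Prod>a\<in>maxima S G. if odd a then x + 1 else xb + 1)"
      by (intro prod.cong) auto
    ultimately show "(\<Sum>B\<in>{B. B \<subset> {a \<in> S. G a = m}}. ?r G * (prod ?w B * ?c B G)) = ?r G *
      ((y + xb) * ((x + 1) ^ mo S G * (xb + 1) ^ me S G) +
       (yb - y - xb) * (x ^ mo S G * xb ^ me S G))"
      using sum_raised_sets[of "maxima S G" ?w xb yb y] even_m finite_S
      by (simp add: sum_distrib_left[symmetric] maxima_weight)
  qed simp
  also have "\<dots> = (y + xb) * Lambda S (x + 1) y z (xb + 1) yb zb +
      (yb - y - xb) * Lambda S x y z xb yb zb"
    by (simp add: Lambda_def sum_distrib_left sum.distrib[symmetric] algebra_simps)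
  finally show ?thesis .
qed

end

section \<open>Consecutive odd numbers followed by consecutive even numbers\<close>

lemma T_Suc:
  assumes "k \<ge> 1" "n \<ge> 1"
  shows "T k (Suc n) = insert (2 * (k + n)) (T k n)"
proof -
  have "k \<le> i \<and> i \<le> k + Suc n - 1 \<longleftrightarrow> i = k + n \<or> k \<le> i \<and> i \<le> k + n - 1" for i
    using assms by arith
  moreover have "{2 * i | i. i = k + n \<or> Q i} = insert (2 * (k + n)) {2 * i | i. Q i}" for Q
    by (auto intro: exI[of _ "k + n"])
  ultimately show ?thesis unfolding T_def by (simp only: Un_insert_right)
qed

lemma T_bounds:
  assumes "k \<ge> 1" "n \<ge> 1"
  shows "finite (T k n)" "a \<in> T k n \<Longrightarrow> a \<le> 2 * (k + n - 1)" "2 * (k + n - 1) \<in> T k n"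
    "a \<in> T k n \<Longrightarrow> odd a \<Longrightarrow> a < 2 * k"
proof -
  show b: "a \<in> T k n \<Longrightarrow> a \<le> 2 * (k + n - 1)" for a using assms by (auto simp: T_def)
  then show "finite (T k n)" using finite_subset[of "T k n" "{..2 * (k + n - 1)}"] by auto
  show "2 * (k + n - 1) \<in> T k n"
    unfolding T_def by (intro UnI2 CollectI exI[of _ "k + n - 1"]) (use assms in simp)
  show "a \<in> T k n \<Longrightarrow> odd a \<Longrightarrow> a < 2 * k" by (auto simp: T_def)
qed

lemma evens_T:
  assumes "k \<ge> 1"
  shows "evens (T k n) = {2 * i | i. k \<le> i \<and> i \<le> k + n - 1}"
  using assms by (auto simp: evens_def T_def)

lemma trunc_T:
  assumes "k \<ge> 1" "n \<ge> 2"
  shows "trunc (T k n) = T k n - {2 * (k + n - 1)}"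
proof -
  let ?m = "2 * (k + n - 1)" and ?l = "2 * (k + n - 2)"
  have fin: "finite (evens (T k n))" using T_bounds(1)[of k n] assms by (simp add: evens_def)
  have M: "Max (evens (T k n)) = ?m"
    using assms fin by (intro Max_eqI) (auto simp: evens_T)
  have l: "?l \<in> evens (T k n)" "?m \<in> evens (T k n)" "?l < ?m"
    using assms by (auto simp: evens_T intro: exI[of _ "k + n - 2"])
  have M': "Max (evens (T k n) - {?m}) = ?l"
    using assms fin l by (intro Max_eqI) (auto simp: evens_T)
  have "card {?l, ?m} \<le> card (evens (T k n))"
    using fin l by (intro card_mono) auto
  then have "card (evens (T k n)) \<ge> 2" using l(3) by simp
  moreover have "a \<le> ?l \<longleftrightarrow> a \<noteq> ?m" if a: "a \<in> T k n" for a
  proof (cases "even a")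
    case True
    then have "a \<in> evens (T k n)" using a by (simp add: evens_def)
    then show ?thesis using assms by (auto simp: evens_T)
  next
    case False
    then have "a < 2 * k" using T_bounds(4)[of k n a] a assms by simp
    then show ?thesis using assms by auto
  qed
  ultimately show ?thesis unfolding trunc_def M M' by auto
qed

text \<open>For \<open>n = 1\<close> the recurrence fails: \<open>trunc (T k 1)\<close> is empty, whereas the \<open>k\<close> odd elements of
  \<open>T k 1\<close> all count in \<open>T k 2\<close>. This is why the expansion starts from \<open>T k 2\<close>.\<close>

lemma Lambda_T_Suc:
  fixes x y z xb yb zb :: "'a::comm_ring_1"
  assumes "k \<ge> 1" "n \<ge> 2"
  shows "Lambda (T k (Suc n)) x y z xb yb zb =
    (y + xb) * Lambda (T k n) (x + 1) y z (xb + 1) yb zb +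
    (yb - y - xb) * Lambda (T k n) x y z xb yb zb"
proof -
  interpret even_top "T k n" "2 * (k + n - 1)" "2 * (k + n)"
    using T_bounds[of k n] trunc_T assms by unfold_locales auto
  show ?thesis using Lambda_insert_top T_Suc[of k n] assms by simp
qed

lemma Lambda_T_1:
  fixes x y z xb yb zb :: "'a::comm_ring_1"
  assumes "k \<ge> 1"
  shows "Lambda (T k 1) x y z xb yb zb = 1"
proof -
  have e: "evens (T k 1) = {2 * k}" using assms by (auto simp: evens_T)
  then have t: "trunc (T k 1) = {}" by (simp add: trunc_def)
  let ?F = "\<lambda>a\<in>T k 1. 2 * k"
  have "2 * k \<in> T k 1" "\<And>a. a \<in> T k 1 \<Longrightarrow> a \<le> 2 * k"
    using T_bounds[of k 1] assms by auto
  then have "?F ` T k 1 = {2 * k}" "\<forall>a\<in>T k 1. a \<le> ?F a"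
    by (auto simp: image_constant_conv)
  moreover have "T k 1 \<rightarrow>\<^sub>E {2 * k} = {?F}"
    by (simp add: PiE_eq_singleton)
  ultimately have "staircases (T k 1) = {?F}"
    unfolding staircases_def e by auto
  then show ?thesis
    unfolding Lambda_def mo_def me_def fd_def fi_def si_def sd_def surfixed_def fixed_def t by simp
qed

section \<open>Solving the functional equation\<close>

text \<open>In the topology of formal power series a sum converges as soon as each coefficient is a finite
  sum; \<open>I i\<close> contains the indices that can contribute to the coefficient of degree \<open>i\<close>.\<close>

lemma has_sum_fps:
  fixes f :: "'b \<Rightarrow> 'a::comm_ring_1 fps"
  assumes "\<And>i. finite (I i)" "\<And>i. I i \<subseteq> A" "\<And>i n. n \<in> A \<Longrightarrow> n \<notin> I i \<Longrightarrow> f n $ i = 0"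
    and "\<And>i. (\<Sum>n\<in>I i. f n $ i) = s $ i"
  shows "(f has_sum s) A"
  unfolding has_sum_def
proof (rule tendsto_fpsI)
  fix i
  show "\<forall>\<^sub>F J in finite_subsets_at_top A. sum f J $ i = s $ i"
    unfolding eventually_finite_subsets_at_top
  proof (intro exI[of _ "I i"] conjI allI impI)
    fix J assume J: "finite J \<and> I i \<subseteq> J \<and> J \<subseteq> A"
    have "(\<Sum>n\<in>I i. f n $ i) = (\<Sum>n\<in>J. f n $ i)"
      using J assms(3) by (intro sum.mono_neutral_left) auto
    then show "sum f J $ i = s $ i" by (simp add: fps_sum_nth assms(4))
  qed (use assms in auto)
qed

lemma fps_over_unique:
  fixes h :: "'a::comm_ring_1 fps"
  assumes "g $ 0 = 1" "h * g = f"
  shows "h = fps_over f g"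
  using fps_right_inverse[of g 1] assms by (auto simp: fps_over_def mult.assoc)

text \<open>The generating functions \<open>G j = Abs_fps (\<lambda>m. l m j)\<close> satisfy
  \<open>(1 - b j X) G j = l 0 j + a j X G (j + 1)\<close>. Solving for \<open>G j\<close> and iterating from \<open>j = 0\<close> leaves
  after \<open>M\<close> steps a remainder \<open>R M\<close> that has only terms of degree greater than \<open>M\<close>, once both sides
  carry the additional factor \<open>X\<close>.\<close>

lemma functional_equation_solution:
  fixes l :: "nat \<Rightarrow> nat \<Rightarrow> 'a::comm_ring_1"
  assumes rec: "\<And>m j. l (Suc m) j = a j * l m (Suc j) + b j * l m j"
  shows "((\<lambda>m. fps_over (fps_const ((\<Prod>i<m. a i) * l 0 m) * fps_X ^ Suc m)
            (\<Prod>i\<le>m. 1 - fps_const (b i) * fps_X))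
          has_sum fps_X * Abs_fps (\<lambda>m. l m 0)) UNIV"
proof -
  define G where "G j = Abs_fps (\<lambda>m. l m j)" for j
  define D where "D i = 1 - fps_const (b i) * fps_X" for i
  define g where "g m = fps_over (fps_const ((\<Prod>i<m. a i) * l 0 m) * fps_X ^ Suc m) (\<Prod>i\<le>m. D i)" for m
  define R where
    "R m = fps_over (fps_const (\<Prod>i<m. a i) * fps_X ^ Suc m * G m) (\<Prod>i<m. D i)" for m
  have D0: "(\<Prod>i\<in>I. D i) $ 0 = 1" for I :: "nat set"
    by (induction I rule: infinite_finite_induct) (simp_all add: D_def)
  have step: "G j * D j = fps_const (l 0 j) + fps_const (a j) * fps_X * G (Suc j)" for j
  proof -
    have "G j * D j = G j - fps_const (b j) * (fps_X * G j)"
      by (simp add: D_def algebra_simps)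
    also have "\<dots> = fps_const (l 0 j) + fps_const (a j) * (fps_X * G (Suc j))"
    proof (rule fps_ext)
      fix i
      show "(G j - fps_const (b j) * (fps_X * G j)) $ i =
          (fps_const (l 0 j) + fps_const (a j) * (fps_X * G (Suc j))) $ i"
        by (cases i) (simp_all add: G_def rec)
    qed
    finally show ?thesis by (simp only: mult.assoc)
  qed
  have R_Suc: "R m = g m + R (Suc m)" for m
  proof -
    have P: "(\<Prod>i<Suc m. D i) = (\<Prod>i<m. D i) * D m" "(\<Prod>i\<le>m. D i) = (\<Prod>i<m. D i) * D m"
      by (simp_all add: lessThan_Suc_atMost[symmetric])
    have "R m * ((\<Prod>i<m. D i) * D m) = fps_const (\<Prod>i<m. a i) * fps_X ^ Suc m * (G m * D m)"
      using fps_over_mult[OF D0[of "{..<m}"]] by (simp add: R_def mult.assoc[symmetric])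
    also have "\<dots> = fps_const ((\<Prod>i<m. a i) * l 0 m) * fps_X ^ Suc m +
        fps_const (\<Prod>i<Suc m. a i) * fps_X ^ Suc (Suc m) * G (Suc m)"
      unfolding step by (simp add: algebra_simps fps_const_mult[symmetric] del: fps_const_mult)
    finally have "R m = fps_over (fps_const ((\<Prod>i<m. a i) * l 0 m) * fps_X ^ Suc m +
        fps_const (\<Prod>i<Suc m. a i) * fps_X ^ Suc (Suc m) * G (Suc m)) (\<Prod>i<Suc m. D i)"
      using D0[of "{..<Suc m}"] by (intro fps_over_unique) (simp_all only: P)
    then show ?thesis
      by (simp add: g_def R_def fps_over_def distrib_right lessThan_Suc_atMost)
  qed
  have partial: "fps_X * G 0 = (\<Sum>m<M. g m) + R M" for M
  proof (induction M)
    case 0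
    have "fps_X * G 0 = R 0" unfolding R_def by (rule fps_over_unique) auto
    then show ?case by simp
  next
    case (Suc M)
    then show ?case using R_Suc[of M] by (simp add: add.assoc)
  qed
  have low: "(fps_over (c * fps_X ^ Suc m * h) d) $ i = 0" if "i \<le> m" for c h d :: "'a fps" and i m
  proof -
    have "fps_over (c * fps_X ^ Suc m * h) d = fps_X ^ Suc m * (c * h * fps_right_inverse d 1)"
      by (simp add: fps_over_def ac_simps)
    then show ?thesis using that by (simp only: fps_X_power_mult_nth) simp
  qed
  have "(g has_sum fps_X * G 0) UNIV"
  proof (rule has_sum_fps)
    fix i n :: nat
    assume "n \<notin> {..<Suc i}"
    then show "g n $ i = 0" using low[of i n _ 1] by (simp add: g_def)
  next
    fix i
    have "R (Suc i) $ i = 0" unfolding R_def by (rule low) simp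
    then show "(\<Sum>n\<in>{..<Suc i}. g n $ i) = (fps_X * G 0) $ i"
      by (subst partial[of "Suc i"]) (simp only: fps_add_nth fps_sum_nth add_0_right)
  qed auto
  then show ?thesis unfolding g_def[abs_def] G_def D_def[abs_def] .
qed

lemma Abs_fps_has_sum:
  fixes c :: "nat \<Rightarrow> 'a::comm_ring_1"
  shows "((\<lambda>n. fps_const (c n) * fps_X ^ (n - 1)) has_sum Abs_fps (\<lambda>m. c (Suc m))) {1..}"
  by (rule has_sum_fps[where I = "\<lambda>i. {Suc i}"]) (auto simp: fps_X_power_iff)

theorem theorem7p2:
  fixes k :: nat
  assumes "k \<ge> 1"
  shows "let
      f = (\<lambda>n. fps_const (Lambda (T k n) X Y Z Xb Yb Zb) * fps_X ^ (n - 1));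
      g = (\<lambda>n. fps_over
            (fps_const (pochhammer (Y + Xb) (n - 2) *
               Lambda (T k 2) (X + of_nat (n - 2)) Y Z (Xb + of_nat (n - 2)) Yb Zb) * fps_X ^ (n - 1))
            (\<Prod>i = 0..n - 2. 1 - fps_const (Yb - Y - (Xb + of_nat i)) * fps_X))
    in f summable_on {1..} \<and> g summable_on {2..} \<and>
       (\<Sum>\<^sub>\<infinity>n\<in>{1..}. f n) = 1 + (\<Sum>\<^sub>\<infinity>n\<in>{2..}. g n)"
proof -
  define f where "f = (\<lambda>n. fps_const (Lambda (T k n) X Y Z Xb Yb Zb) * fps_X ^ (n - 1))"
  define g where "g = (\<lambda>n. fps_over
            (fps_const (pochhammer (Y + Xb) (n - 2) *
               Lambda (T k 2) (X + of_nat (n - 2)) Y Z (Xb + of_nat (n - 2)) Yb Zb) * fps_X ^ (n - 1))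
            (\<Prod>i = 0..n - 2. 1 - fps_const (Yb - Y - (Xb + of_nat i)) * fps_X))"
  \<comment> \<open>The second index counts how often \<open>x\<close> and \<open>xb\<close> have been shifted by one.\<close>
  define l where "l m j = Lambda (T k (m + 2)) (X + of_nat j) Y Z (Xb + of_nat j) Yb Zb" for m j
  have rec: "l (Suc m) j = (Y + Xb + of_nat j) * l m (Suc j) + (Yb - Y - (Xb + of_nat j)) * l m j"
    for m j
    using Lambda_T_Suc[OF assms, of "m + 2" "X + of_nat j" Y Z "Xb + of_nat j" Yb Zb]
    by (simp add: l_def add.assoc add.commute[of 1])
  have "((\<lambda>m. fps_over (fps_const ((\<Prod>i<m. Y + Xb + of_nat i) * l 0 m) * fps_X ^ Suc m)
            (\<Prod>i\<le>m. 1 - fps_const (Yb - Y - (Xb + of_nat i)) * fps_X))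
          has_sum fps_X * Abs_fps (\<lambda>m. l m 0)) UNIV"
    by (rule functional_equation_solution) (rule rec)
  also have "?this \<longleftrightarrow> (g has_sum fps_X * Abs_fps (\<lambda>m. l m 0)) {2..}"
    by (rule has_sum_reindex_bij_witness[where j = "\<lambda>m. m + 2" and i = "\<lambda>n. n - 2"])
      (auto simp: g_def l_def pochhammer_prod atLeast0LessThan atLeast0AtMost numeral_2_eq_2)
  finally have g: "(g has_sum fps_X * Abs_fps (\<lambda>m. l m 0)) {2..}" .
  have "(f has_sum Abs_fps (\<lambda>m. Lambda (T k (Suc m)) X Y Z Xb Yb Zb)) {1..}"
    unfolding f_def by (rule Abs_fps_has_sum)
  also have "Abs_fps (\<lambda>m. Lambda (T k (Suc m)) X Y Z Xb Yb Zb) =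
      1 + fps_X * Abs_fps (\<lambda>m. l m 0)"
  proof (rule fps_ext)
    fix i
    show "Abs_fps (\<lambda>m. Lambda (T k (Suc m)) X Y Z Xb Yb Zb) $ i =
        (1 + fps_X * Abs_fps (\<lambda>m. l m 0)) $ i"
      using Lambda_T_1[OF assms, of X Y Z Xb Yb Zb] by (cases i) (simp_all add: l_def)
  qed
  finally have f: "(f has_sum 1 + fps_X * Abs_fps (\<lambda>m. l m 0)) {1..}" .
  have "f summable_on {1..} \<and> g summable_on {2..} \<and>
       (\<Sum>\<^sub>\<infinity>n\<in>{1..}. f n) = 1 + (\<Sum>\<^sub>\<infinity>n\<in>{2..}. g n)"
    using f g by (simp add: has_sum_imp_summable infsumI)
  then show ?thesis by (simp add: f_def g_def Let_def)
qed

end
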